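(* Let $k\ge 0$ be an integer and let $B_1,B_2$ be $k$-strict barcodes with $n$ bars. If $g_k(B_1)=g_k(B_2)$, then $g_j(B_1)=g_j(B_2)$ for all integers $0\le j<k$.
   Context: A barcode with $n$ bars is a finite multiset of intervals on the real line $B=\{(b_i,d_i)\}_{i=1}^n$ with $b_i<d_i$ for all $i\in[n]=\{1,\ldots,n\}$; the indexing by $[n]$ is a choice of labeling. For an integer $k\ge0$, $B$ is $k$-strict if the sets $\{b_i+\ell\frac{d_i-b_i}{2^k}:\ell=0,\ldots,2^k\}$ and $\{b_j+\ell\frac{d_j-b_j}{2^k}:\ell=0,\ldots,2^k\}$ are disjoint for all $i\ne j$ (a $k$-strict barcode is $j$-strict for all $0\le j\le k$). $L((2^k+1)^n)$ is the set of all permutations (words) of the multiset in which each of $1,\ldots,n$ has multiplicity $2^k+1$. For a $k$-strict barcode $B$, the $n(2^k+1)$ points $b_i+\ell\frac{d_i-b_i}{2^k}$ ($i\in[n]$, $0\le\ell\le 2^k$) are distinct; list them in increasing order and let $f_k(B)\in L((2^k+1)^n)$ be the word whose $r$-th letter is the index $i$ of the bar from which the $r$-th smallest point comes. $\mathfrak{S}_n$ acts on $L((2^k+1)^n)$ by applying a permutation to every letter, and $g_k(B)=[f_k(B)]\in L((2^k+1)^n)/\mathfrak{S}_n$ is the orbit of $f_k(B)$; it does not depend on the labeling of the bars. *)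

theory Defs
  imports
    "HOL-Combinatorics.Multiset_Permutations"
    "HOL-Algebra.Sym_Groups"
    "HOL-Algebra.Group_Action"
    Complex_Main
begin

definition barcode :: "nat \<Rightarrow> (real \<times> real) multiset \<Rightarrow> bool" where
  "barcode n B \<longleftrightarrow> size B = n \<and> (\<forall>(b, d) \<in># B. b < d)"

(* A labeling assigns to each index in {1..n}, n being the number of bars, a bar of B;
   its values outside {1..n} are irrelevant. *)
definition labeling :: "(nat \<Rightarrow> real \<times> real) \<Rightarrow> (real \<times> real) multiset \<Rightarrow> bool" where
  "labeling \<beta> B \<longleftrightarrow> image_mset \<beta> (mset_set {1..size B}) = B"

definition dyadic_points :: "nat \<Rightarrow> real \<times> real \<Rightarrow> real set" where
  "dyadic_points k = (\<lambda>(b, d). {b + real l * ((d - b) / 2 ^ k) |l. l \<in> {0..2 ^ k}})"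

(* Labelings always exist and differ by a permutation of {1..n} (see labeling_exists and
   labeling_permute), so quantifying over all of them amounts to picking any one. *)
definition k_strict :: "nat \<Rightarrow> (real \<times> real) multiset \<Rightarrow> bool" where
  "k_strict k B \<longleftrightarrow>
     (\<forall>\<beta>. labeling \<beta> B \<longrightarrow>
       (\<forall>i \<in> {1..size B}. \<forall>j \<in> {1..size B}. i \<noteq> j \<longrightarrow>
         dyadic_points k (\<beta> i) \<inter> dyadic_points k (\<beta> j) = {}))"

definition words :: "nat \<Rightarrow> nat \<Rightarrow> nat list set" where
  "words n m = permutations_of_multiset (\<Sum>i\<in>{1..n}. replicate_mset m i)"

(* Meaningful when the point sets of the n bars are pairwise disjoint, which makes the
   bar of each point unique. *)
definition f_word :: "nat \<Rightarrow> nat \<Rightarrow> (nat \<Rightarrow> real \<times> real) \<Rightarrow> nat list" where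
  "f_word n k \<beta> =
     map (\<lambda>x. THE i. i \<in> {1..n} \<and> x \<in> dyadic_points k (\<beta> i))
       (sorted_list_of_set (\<Union>i\<in>{1..n}. dyadic_points k (\<beta> i)))"

(* The choice of labeling does not matter for k-strict barcodes, see g_orbit_eq. *)
definition g_orbit :: "nat \<Rightarrow> (real \<times> real) multiset \<Rightarrow> nat list set" where
  "g_orbit k B = orbit (sym_group (size B)) map (f_word (size B) k (SOME \<beta>. labeling \<beta> B))"

lemma labeling_exists: "\<exists>\<beta>. labeling \<beta> B"
proof -
  obtain xs where xs: "mset xs = B" using ex_mset by blast
  have "image_mset (\<lambda>i. xs ! (i - 1)) (mset_set {1..length xs})
      = image_mset (\<lambda>i. xs ! (i - 1)) (image_mset Suc (mset_set {0..<length xs}))"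
    by (simp add: image_mset_mset_set image_Suc_atLeastLessThan atLeastLessThanSuc_atLeastAtMost)
  also have "\<dots> = mset (map (\<lambda>i. xs ! i) [0..<length xs])"
    by (simp add: multiset.map_comp o_def)
  also have "\<dots> = B" by (simp only: map_nth xs)
  finally show ?thesis unfolding labeling_def using xs by auto
qed

lemma labeling_permute:
  assumes "labeling \<beta> B" "labeling \<gamma> B"
  obtains p where "p permutes {1..size B}" "\<And>i. i \<in> {1..size B} \<Longrightarrow> \<beta> i = \<gamma> (p i)"
proof -
  have "image_mset \<beta> (mset_set {1..size B}) = image_mset \<gamma> (mset_set {1..size B})"
    using assms unfolding labeling_def by simp
  from image_mset_eq_implies_permutes[OF finite_atLeastAtMost this]
  obtain p where "p permutes {1..size B}" "\<forall>i\<in>{1..size B}. \<beta> i = \<gamma> (p i)" .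
  then show thesis by (intro that) (auto dest: bspec)
qed

lemma finite_dyadic_points: "finite (dyadic_points k x)"
  by (auto simp: dyadic_points_def split_beta)

lemma card_dyadic_points:
  assumes "b < d"
  shows "card (dyadic_points k (b, d)) = 2 ^ k + 1"
proof -
  have "dyadic_points k (b, d) = (\<lambda>l. b + real l * ((d - b) / 2 ^ k)) ` {0..2 ^ k}"
    by (auto simp: dyadic_points_def)
  moreover have "inj_on (\<lambda>l. b + real l * ((d - b) / 2 ^ k)) {0..2 ^ k}"
    using assms by (auto simp: inj_on_def)
  ultimately show ?thesis by (simp add: card_image)
qed

lemma k_strict_mono:
  assumes "k_strict k B" "j \<le> k"
  shows "k_strict j B"
proof -
  have "dyadic_points j x \<subseteq> dyadic_points k x" for x
  proof
    fix y assume "y \<in> dyadic_points j x"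
    then obtain l where l: "l \<le> 2 ^ j" "y = fst x + real l * ((snd x - fst x) / 2 ^ j)"
      by (auto simp: dyadic_points_def split_beta)
    have "(2::real) ^ k = 2 ^ j * 2 ^ (k - j)" "(2::nat) ^ k = 2 ^ j * 2 ^ (k - j)"
      using assms(2) by (simp_all flip: power_add)
    then have "l * 2 ^ (k - j) \<le> 2 ^ k"
      "y = fst x + real (l * 2 ^ (k - j)) * ((snd x - fst x) / 2 ^ k)"
      using l by auto
    then show "y \<in> dyadic_points k x"
      unfolding dyadic_points_def split_beta by fastforce
  qed
  then show ?thesis
    using assms(1) unfolding k_strict_def by blast
qed

lemma the_bar:
  assumes "k_strict k B" "labeling \<beta> B" "i \<in> {1..size B}" "x \<in> dyadic_points k (\<beta> i)"
  shows "(THE i. i \<in> {1..size B} \<and> x \<in> dyadic_points k (\<beta> i)) = i"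
proof (rule the_equality)
  show "i \<in> {1..size B} \<and> x \<in> dyadic_points k (\<beta> i)"
    using assms by simp
next
  fix j assume j: "j \<in> {1..size B} \<and> x \<in> dyadic_points k (\<beta> j)"
  show "j = i"
  proof (rule ccontr)
    assume "j \<noteq> i"
    then have "dyadic_points k (\<beta> j) \<inter> dyadic_points k (\<beta> i) = {}"
      using assms(1-3) j by (simp add: k_strict_def)
    then show False using assms(4) j by auto
  qed
qed

lemma count_mset_map_sorted:
  fixes S :: "real set"
  assumes "finite S"
  shows "count (mset (map h (sorted_list_of_set S))) i = card {x \<in> S. h x = i}"
proof -
  have "mset (sorted_list_of_set S) = mset_set S"
    by (metis mset_sorted_list_of_multiset sorted_list_of_mset_set)
  then have "count (mset (map h (sorted_list_of_set S))) i
      = (\<Sum>x | x \<in> S \<and> i = h x. count (mset_set S) x)"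
    using assms by (simp add: count_image_mset')
  also have "\<dots> = (\<Sum>x | x \<in> S \<and> i = h x. 1)"
    using assms by (intro sum.cong) auto
  finally show ?thesis by (simp add: eq_commute)
qed

lemma f_word_in_words:
  assumes "barcode n B" "k_strict k B" "labeling \<beta> B"
  shows "f_word n k \<beta> \<in> words n (2 ^ k + 1)"
proof -
  have n: "n = size B" using assms(1) by (simp add: barcode_def)
  let ?S = "\<Union>i\<in>{1..n}. dyadic_points k (\<beta> i)"
  let ?h = "\<lambda>x. THE i. i \<in> {1..n} \<and> x \<in> dyadic_points k (\<beta> i)"
  have fin: "finite ?S" by (simp add: finite_dyadic_points)
  have h: "?h x = i" if "i \<in> {1..n}" "x \<in> dyadic_points k (\<beta> i)" for i x
    using the_bar[OF assms(2,3)] that unfolding n by blast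
  have "count (mset (f_word n k \<beta>)) i = count (\<Sum>i\<in>{1..n}. replicate_mset (2 ^ k + 1) i) i" for i
  proof -
    have L: "count (mset (f_word n k \<beta>)) i = card {x \<in> ?S. ?h x = i}"
      unfolding f_word_def using count_mset_map_sorted[OF fin] .
    have R: "count (\<Sum>i\<in>{1..n}. replicate_mset m i) i = (if i \<in> {1..n} then m else 0)" for m
      by (simp add: count_sum)
    show ?thesis
    proof (cases "i \<in> {1..n}")
      case True
      then have eq: "{x \<in> ?S. ?h x = i} = dyadic_points k (\<beta> i)"
        using h by blast
      have "\<beta> i \<in># B"
        using assms(3) True unfolding labeling_def n
        by (metis finite_atLeastAtMost finite_set_mset_mset_set imageI set_image_mset)
      then have "fst (\<beta> i) < snd (\<beta> i)"
        using assms(1) by (auto simp: barcode_def)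
      then have "card (dyadic_points k (\<beta> i)) = 2 ^ k + 1"
        using card_dyadic_points[of "fst (\<beta> i)" "snd (\<beta> i)" k] by simp
      then show ?thesis unfolding L R eq using True by (simp only: if_True)
    next
      case False
      then have "{x \<in> ?S. ?h x = i} = {}"
        using h by blast
      then show ?thesis unfolding L R using False by (simp only: card.empty if_False)
    qed
  qed
  then show ?thesis
    unfolding words_def by (intro permutations_of_multisetI multiset_eqI)
qed

lemma g_orbit_eq:
  assumes "k_strict k B" "labeling \<beta> B"
  shows "g_orbit k B = orbit (sym_group (size B)) map (f_word (size B) k \<beta>)"
proof -
  let ?n = "size B"
  have f_permute: "f_word ?n k \<delta> = map p (f_word ?n k \<gamma>)"
    if l: "labeling \<gamma> B" "labeling \<delta> B" and p: "p permutes {1..?n}"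
      and eq: "\<And>i. i \<in> {1..?n} \<Longrightarrow> \<gamma> i = \<delta> (p i)" for \<gamma> \<delta> p
  proof -
    have "(\<Union>i\<in>{1..?n}. dyadic_points k (\<delta> i)) = (\<Union>i\<in>p ` {1..?n}. dyadic_points k (\<delta> i))"
      by (simp only: permutes_image[OF p])
    also have "\<dots> = (\<Union>i\<in>{1..?n}. dyadic_points k (\<gamma> i))"
      by (simp add: eq)
    finally have U: "(\<Union>i\<in>{1..?n}. dyadic_points k (\<delta> i)) = (\<Union>i\<in>{1..?n}. dyadic_points k (\<gamma> i))" .
    have "(THE i. i \<in> {1..?n} \<and> x \<in> dyadic_points k (\<delta> i))
        = p (THE i. i \<in> {1..?n} \<and> x \<in> dyadic_points k (\<gamma> i))"
      if x: "x \<in> (\<Union>i\<in>{1..?n}. dyadic_points k (\<gamma> i))" for x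
    proof -
      obtain i where i: "i \<in> {1..?n}" "x \<in> dyadic_points k (\<gamma> i)" using x by blast
      have "p i \<in> {1..?n}" using p i(1) by (simp only: permutes_in_image)
      moreover have "x \<in> dyadic_points k (\<delta> (p i))" using i eq by simp
      ultimately show ?thesis
        using the_bar[OF assms(1) l(2)] the_bar[OF assms(1) l(1) i] by simp
    qed
    then show ?thesis
      unfolding f_word_def U by (simp add: finite_dyadic_points)
  qed
  have sub: "orbit (sym_group ?n) map (f_word ?n k \<delta>) \<subseteq> orbit (sym_group ?n) map (f_word ?n k \<gamma>)"
    if l: "labeling \<gamma> B" "labeling \<delta> B" for \<gamma> \<delta>
  proof -
    obtain p where p: "p permutes {1..?n}" "\<And>i. i \<in> {1..?n} \<Longrightarrow> \<gamma> i = \<delta> (p i)"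
      using labeling_permute[OF l] by blast
    have "f_word ?n k \<delta> = map p (f_word ?n k \<gamma>)"
      using f_permute[OF l p] .
    then show ?thesis
      using permutes_compose[OF p(1)] unfolding orbit_def sym_group_carrier
      by (auto simp flip: map_map comp_assoc) (metis map_map)
  qed
  have "labeling (SOME \<beta>. labeling \<beta> B) B"
    using labeling_exists by (rule someI_ex)
  then show ?thesis
    unfolding g_orbit_def using sub assms(2) by blast
qed

end

(* The j-points of a bar are exactly those of its k-points that have a multiple of 2^(k-j)
   k-points of the same bar to their left. So the word at level j arises from the word at level k
   by keeping the letters whose number of earlier occurrences is a multiple of 2^(k-j), and this
   operation commutes with relabeling. *)
theory Submission
  imports Defs
begin

text \<open>Used with \<open>m = 2 ^ (k - j)\<close>. Since \<open>take r w\<close> stops before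
  position \<open>r\<close>, occurrences of a letter are numbered from 0, just as \<open>l\<close>
  numbers the points of a bar from its left endpoint.\<close>

definition thin :: "nat \<Rightarrow> 'a list \<Rightarrow> 'a list" where
  "thin m w = map ((!) w) (filter (\<lambda>r. m dvd count_list (take r w) (w ! r)) [0..<length w])"

text \<open>An injective relabeling merges no letters, so every position keeps its number of earlier
  occurrences and the same positions survive.\<close>

lemma thin_map:
  assumes "inj p"
  shows "thin m (map p w) = map p (thin m w)"
proof -
  have "filter (\<lambda>r. m dvd count_list (take r (map p w)) (map p w ! r)) [0..<length w]
      = filter (\<lambda>r. m dvd count_list (take r w) (w ! r)) [0..<length w]"
    using assms by (intro filter_cong refl) (simp add: take_map count_list_map_conv)
  then show ?thesis
    unfolding thin_def by simp
qed

text \<open>The entries before a given one in the increasing list are exactly the smaller elements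
  of \<open>S\<close>. This trades positions in a word for the order of points on the line.\<close>

lemma thin_map_sorted_list_of_set:
  fixes S :: "real set"
  assumes "finite S"
  shows "thin m (map h (sorted_list_of_set S)) =
    map h (sorted_list_of_set {x \<in> S. m dvd card {y \<in> S. y < x \<and> h y = h x}})"
proof -
  define xs where "xs = sorted_list_of_set S"
  have xs: "sorted_wrt (<) xs" "set xs = S" "distinct xs"
    using assms unfolding xs_def by auto
  let ?P = "\<lambda>x. m dvd card {y \<in> S. y < x \<and> h y = h x}"
  have count: "count_list (take r (map h xs)) (map h xs ! r) = card {y \<in> S. y < xs ! r \<and> h y = h (xs ! r)}"
    if r: "r < length xs" for r
  proof -
    have "count_list (map h ys) c = card {y \<in> set ys. h y = c}" if "distinct ys" for ys c
    proof -
      have "count_list (map h ys) c = length (filter (\<lambda>y. h y = c) ys)"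
        by (induction ys) auto
      also have "\<dots> = card (set (filter (\<lambda>y. h y = c) ys))"
        using that by (intro distinct_card[symmetric]) simp
      finally show ?thesis by simp
    qed
    moreover have "set (take r xs) = {y \<in> S. y < xs ! r}"
    proof -
      have "xs ! i < xs ! r \<longleftrightarrow> i < r" if "i < length xs" for i
        using sorted_wrt_nth_less[OF xs(1)] that r by (metis less_asym nat_neq_iff)
      then have "{i. i < length xs \<and> xs ! i < xs ! r} = {0..<r}"
        using r by auto
      moreover have "{y \<in> S. y < xs ! r} = (!) xs ` {i. i < length xs \<and> xs ! i < xs ! r}"
        unfolding xs(2)[symmetric] set_conv_nth by blast
      ultimately show ?thesis
        using r by (simp add: nth_image)
    qed
    ultimately show ?thesis
      using r xs(3) by (simp add: take_map conj_assoc)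
  qed
  have "thin m (map h xs) = map (\<lambda>r. h (xs ! r)) (filter (\<lambda>r. ?P (xs ! r)) [0..<length xs])"
  proof -
    have "filter (\<lambda>r. m dvd count_list (take r (map h xs)) (map h xs ! r)) [0..<length xs]
        = filter (\<lambda>r. ?P (xs ! r)) [0..<length xs]"
      by (intro filter_cong refl) (simp only: count set_upt atLeastLessThan_iff)
    then show ?thesis unfolding thin_def by simp
  qed
  also have "\<dots> = map h (filter ?P (map ((!) xs) [0..<length xs]))"
    by (simp add: filter_map o_def)
  also have "\<dots> = map h (filter ?P xs)"
    by (simp only: map_nth)
  \<comment> \<open>Both sides are sorted, repetition-free lists with the same elements.\<close>
  also have "filter ?P xs = sorted_list_of_set {x \<in> S. ?P x}"
    using assms unfolding xs_def
    by (intro sorted_distinct_set_unique) (auto simp: sorted_wrt_filter)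
  finally show ?thesis unfolding xs_def .
qed

text \<open>The step at level \<open>j\<close> is \<open>2 ^ (k - j)\<close> steps at level
  \<open>k\<close>, so point \<open>q\<close> at level \<open>j\<close> sits at index
  \<open>2 ^ (k - j) * q\<close> on the finer grid; as \<open>b < d\<close>, no other index gives
  that point.\<close>

lemma dyadic_point_eq_iff:
  fixes b d :: real
  assumes "b < d" "j \<le> k"
  shows "b + real l * ((d - b) / 2 ^ k) \<in> dyadic_points j (b, d) \<longleftrightarrow> 2 ^ (k - j) dvd l \<and> l \<le> 2 ^ k"
proof -
  have p: "(2::real) ^ k = 2 ^ j * 2 ^ (k - j)" "(2::nat) ^ k = 2 ^ j * 2 ^ (k - j)"
    using assms(2) by (simp_all flip: power_add)
  have "b + real l * ((d - b) / 2 ^ k) = b + real q * ((d - b) / 2 ^ j) \<longleftrightarrow> l = 2 ^ (k - j) * q" for q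
  proof -
    have "b + real q * ((d - b) / 2 ^ j) = b + real (2 ^ (k - j) * q) * ((d - b) / 2 ^ k)"
      by (simp add: p(1))
    then show ?thesis using assms(1) by (auto simp del: of_nat_mult)
  qed
  then have "b + real l * ((d - b) / 2 ^ k) \<in> dyadic_points j (b, d) \<longleftrightarrow> (\<exists>q\<le>2 ^ j. l = 2 ^ (k - j) * q)"
    unfolding dyadic_points_def by auto
  \<comment> \<open>Cancelling \<open>2 ^ (k - j)\<close> turns the bound
    \<open>l \<le> 2 ^ k\<close> into \<open>q \<le> 2 ^ j\<close>.\<close>
  also have "\<dots> \<longleftrightarrow> 2 ^ (k - j) dvd l \<and> l \<le> 2 ^ k"
    unfolding p(2) by (auto simp: dvd_def mult.commute)
  finally show ?thesis .
qed

lemma card_dyadic_points_less: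
  fixes b d :: real
  assumes "b < d" "l \<le> 2 ^ k"
  shows "card {y \<in> dyadic_points k (b, d). y < b + real l * ((d - b) / 2 ^ k)} = l"
proof -
  have "0 < (d - b) / 2 ^ k" using assms(1) by simp
  then have "{y \<in> dyadic_points k (b, d). y < b + real l * ((d - b) / 2 ^ k)}
      = (\<lambda>l. b + real l * ((d - b) / 2 ^ k)) ` {..<l}"
    using assms(2) unfolding dyadic_points_def
    by (auto simp del: times_divide_eq_right simp: mult_less_cancel_right_pos)
  moreover have "inj_on (\<lambda>l. b + real l * ((d - b) / 2 ^ k)) {..<l}"
    using assms(1) by (auto simp: inj_on_def)
  ultimately show ?thesis by (simp add: card_image)
qed

text \<open>The index of a point in its bar equals the number of points of the bar to its left.
  Hence the order of the points alone decides which of them survive at level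
  \<open>j\<close>.\<close>

lemma mem_dyadic_points_iff_dvd_card:
  assumes "b < d" "j \<le> k" "x \<in> dyadic_points k (b, d)"
  shows "x \<in> dyadic_points j (b, d) \<longleftrightarrow> 2 ^ (k - j) dvd card {y \<in> dyadic_points k (b, d). y < x}"
proof -
  obtain l where l: "l \<le> 2 ^ k" "x = b + real l * ((d - b) / 2 ^ k)"
    using assms(3) by (auto simp: dyadic_points_def)
  show ?thesis
    unfolding l(2) card_dyadic_points_less[OF assms(1) l(1)] dyadic_point_eq_iff[OF assms(1,2)]
    using l(1) by blast
qed

lemma dyadic_points_mono:
  assumes "b < d" "j \<le> k"
  shows "dyadic_points j (b, d) \<subseteq> dyadic_points k (b, d)"
proof
  fix x assume "x \<in> dyadic_points j (b, d)"
  then obtain l where l: "l \<le> 2 ^ j" "x = b + real l * ((d - b) / 2 ^ j)"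
    by (auto simp: dyadic_points_def)
  have p: "(2::real) ^ k = 2 ^ j * 2 ^ (k - j)" "(2::nat) ^ k = 2 ^ j * 2 ^ (k - j)"
    using assms(2) by (simp_all flip: power_add)
  have "x = b + real (l * 2 ^ (k - j)) * ((d - b) / 2 ^ k)"
    unfolding l(2) by (simp add: p(1))
  moreover have "l * 2 ^ (k - j) \<le> 2 ^ k"
    unfolding p(2) using l(1) by simp
  \<comment> \<open>The index criterion is applied with both levels equal to \<open>k\<close>, where
    the divisor is 1 and only the bound on the index remains.\<close>
  ultimately show "x \<in> dyadic_points k (b, d)"
    using dyadic_point_eq_iff[OF assms(1) order_refl] by (simp del: of_nat_mult)
qed

lemma f_word_eq_thin:
  assumes "barcode n B" "k_strict k B" "labeling \<beta> B" "j \<le> k"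
  shows "f_word n j \<beta> = thin (2 ^ (k - j)) (f_word n k \<beta>)"
proof -
  have n: "n = size B" using assms(1) by (simp add: barcode_def)
  let ?S = "\<lambda>k. \<Union>i\<in>{1..n}. dyadic_points k (\<beta> i)"
  let ?h = "\<lambda>k x. THE i. i \<in> {1..n} \<and> x \<in> dyadic_points k (\<beta> i)"
  have h: "?h k x = i" if "i \<in> {1..n}" "x \<in> dyadic_points k (\<beta> i)" for i x
    using the_bar[OF assms(2,3)] that unfolding n by blast
  have hj: "?h j x = i" if "i \<in> {1..n}" "x \<in> dyadic_points j (\<beta> i)" for i x
    using the_bar[OF k_strict_mono[OF assms(2,4)] assms(3)] that unfolding n by blast
  have bar: "fst (\<beta> i) < snd (\<beta> i)" if "i \<in> {1..n}" for i
  proof -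
    have "\<beta> i \<in># B"
      using assms(3) that unfolding labeling_def n
      by (metis finite_atLeastAtMost finite_set_mset_mset_set imageI set_image_mset)
    then show ?thesis using assms(1) by (auto simp: barcode_def)
  qed
  have sub: "dyadic_points j (\<beta> i) \<subseteq> dyadic_points k (\<beta> i)" if "i \<in> {1..n}" for i
    using dyadic_points_mono[OF bar[OF that] assms(4)] by simp
  have selected: "2 ^ (k - j) dvd card {y \<in> ?S k. y < x \<and> ?h k y = ?h k x}
      \<longleftrightarrow> x \<in> dyadic_points j (\<beta> i)" if i: "i \<in> {1..n}" "x \<in> dyadic_points k (\<beta> i)" for i x
  proof -
    \<comment> \<open>By \<open>k\<close>-strictness the letter of a point determines its bar, so
      the points with the letter of \<open>x\<close> are the points of bar \<open>i\<close>.\<close>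
    have "{y \<in> ?S k. y < x \<and> ?h k y = ?h k x} = {y \<in> dyadic_points k (\<beta> i). y < x}"
      unfolding h[OF i] using h i(1) by blast
    then show ?thesis
      using mem_dyadic_points_iff_dvd_card[OF bar[OF i(1)] assms(4)] i(2) by simp
  qed
  have "thin (2 ^ (k - j)) (f_word n k \<beta>) = map (?h k) (sorted_list_of_set
      {x \<in> ?S k. 2 ^ (k - j) dvd card {y \<in> ?S k. y < x \<and> ?h k y = ?h k x}})"
    unfolding f_word_def
    by (intro thin_map_sorted_list_of_set) (simp add: finite_dyadic_points)
  also have "{x \<in> ?S k. 2 ^ (k - j) dvd card {y \<in> ?S k. y < x \<and> ?h k y = ?h k x}} = ?S j"
    using selected sub by blast
  \<comment> \<open>A point of bar \<open>i\<close> at level \<open>j\<close> also belongs to bar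
    \<open>i\<close> at level \<open>k\<close>, so both levels give it the letter
    \<open>i\<close>.\<close>
  also have "map (?h k) (sorted_list_of_set (?S j)) = map (?h j) (sorted_list_of_set (?S j))"
  proof (rule map_cong[OF refl])
    fix x assume "x \<in> set (sorted_list_of_set (?S j))"
    then obtain i where "i \<in> {1..n}" "x \<in> dyadic_points j (\<beta> i)"
      by (auto simp: finite_dyadic_points)
    then show "?h k x = ?h j x" using h hj sub by blast
  qed
  finally show ?thesis unfolding f_word_def ..
qed

text \<open>The map on the right depends on \<open>k - j\<close> but not on \<open>B\<close>, so
  equal orbits at level \<open>k\<close> have equal images at level \<open>j\<close>.\<close>

lemma g_orbit_eq_thin_image:
  assumes "barcode n B" "k_strict k B" "j \<le> k"
  shows "g_orbit j B = thin (2 ^ (k - j)) ` g_orbit k B"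
proof -
  obtain \<beta> where \<beta>: "labeling \<beta> B" using labeling_exists by blast
  have n: "size B = n" using assms(1) by (simp add: barcode_def)
  have orbit: "orbit (sym_group n) map w = (\<lambda>p. map p w) ` {p. p permutes {1..n}}" for w :: "nat list"
    by (auto simp: orbit_def sym_group_carrier)
  show ?thesis
    unfolding g_orbit_eq[OF assms(2) \<beta>] g_orbit_eq[OF k_strict_mono[OF assms(2,3)] \<beta>] n
      f_word_eq_thin[OF assms(1,2) \<beta> assms(3)] orbit image_image
    \<comment> \<open>A permutation of \<open>{1..n}\<close> fixes all other numbers, so it is
      injective on the whole type, as \<open>thin_map\<close> asks.\<close>
    by (intro image_cong refl) (simp add: thin_map permutes_inj)
qed

theorem lemma1:
  fixes k n :: nat and B1 B2 :: "(real \<times> real) multiset"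
  assumes "barcode n B1" and "barcode n B2"
    and "k_strict k B1" and "k_strict k B2"
    and "g_orbit k B1 = g_orbit k B2"
  shows "\<forall>j<k. g_orbit j B1 = g_orbit j B2"
proof (intro allI impI)
  fix j assume "j < k"
  then have "j \<le> k" by simp
  then show "g_orbit j B1 = g_orbit j B2"
    using g_orbit_eq_thin_image[OF assms(1,3)] g_orbit_eq_thin_image[OF assms(2,4)] assms(5)
    by metis
qed

end
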